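(* Assume that the discrete metric terms satisfy the discrete geometric conservation law and the surface consistency condition stated in the context, and that the two-point flux $\boldsymbol f_s$ and the numerical surface flux are consistent with the physical flux $\boldsymbol f$. Then the NSFR discretization with the weight-adjusted inverse is free-stream preserving. That is, let the discrete solution be equal to the same constant state $\boldsymbol u_\infty$ in every element (and in the exterior boundary data), so that the physical flux is a constant $\boldsymbol f_n=\boldsymbol\alpha_n\in\mathbb R^{1\times 3}$ for each state $n$. Then for every element $m$ and every state $n=1,\dots,n_{\mathrm{state}}$, $$\left[\boldsymbol\chi(\boldsymbol\xi_v)^T\ \boldsymbol\chi(\boldsymbol\xi_f)^T\right]\left[(\tilde{\boldsymbol Q}-\tilde{\boldsymbol Q}^T)\odot \boldsymbol F^r_{m,n}\right]\boldsymbol 1^T+\sum_{f=1}^{N_f}\sum_{k=1}^{N_{fp}}\boldsymbol\chi(\boldsymbol\xi_{fk})^TW_{fk}\,\hat{\boldsymbol n}^r_{f}\cdot\left(\boldsymbol\alpha_n\boldsymbol C_m(\boldsymbol\xi_{fk})\right)=\boldsymbol 0^T,$$ and consequently $\frac{d}{dt}\hat{\boldsymbol u}_{m,n}=\boldsymbol 0$.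
   Context: Conservation law: $\partial_t u_n+\nabla\cdot\boldsymbol f_n(\boldsymbol u)=0$, $n=1,\dots,n_{\mathrm{state}}$, in $d=3$ dimensions (for example the compressible Euler equations), with $\boldsymbol f_n(\boldsymbol u)\in\mathbb R^{1\times 3}$. Vectors are row vectors. It has a convex entropy $U(\boldsymbol u)$ with invertible entropy variables $\boldsymbol v=U'(\boldsymbol u)$. Reference element and quadrature: the reference element is $[-1,1]^3$ with $N_f=6$ faces and reference outward unit normals $\hat{\boldsymbol n}^r_f$. The volume nodes $\boldsymbol\xi_v$ ($N_v$ of them) form a tensor product quadrature, with positive weights in the diagonal matrix $\boldsymbol W$. The face nodes are $\boldsymbol\xi_{fk}$, $f=1,\dots,N_f$, $k=1,\dots,N_{fp}$, with weights $W_{fk}$, and $\boldsymbol W_f$ is the diagonal matrix of the weights on face $f$. Bases: $\boldsymbol\chi=[\chi_1,\dots,\chi_{N_p}]$, $N_p=(p+1)^3$, is a tensor product polynomial basis of order $p$ in each variable (the span contains the constants), and $\boldsymbol\chi(\boldsymbol\xi_v)$ is the $N_v\times N_p$ matrix of its values, of full column rank. $\boldsymbol\chi(\boldsymbol\xi_f)$ is the matrix of its values at all face nodes. $\boldsymbol\phi$ is the tensor product Lagrange basis collocated on the volume nodes, of order high enough that its span contains that of $\boldsymbol\chi$, so $\boldsymbol\phi(\boldsymbol\xi_{fk})\boldsymbol\chi(\boldsymbol\xi_v)=\boldsymbol\chi(\boldsymbol\xi_{fk})$. It satisfies the summation-by-parts property, in each reference direction, $$\boldsymbol W\nabla^r\boldsymbol\phi(\boldsymbol\xi_v)+\nabla^r\boldsymbol\phi(\boldsymbol\xi_v)^T\boldsymbol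 W=\sum_f\boldsymbol\phi(\boldsymbol\xi_f)^T\boldsymbol W_f\,\mathrm{diag}(\hat{\boldsymbol n}^r_f)\boldsymbol\phi(\boldsymbol\xi_f).$$ Skew-symmetric operator: in each of the three reference directions, $$\tilde{\boldsymbol Q}-\tilde{\boldsymbol Q}^T=\begin{bmatrix}\boldsymbol W\nabla^r\boldsymbol\phi(\boldsymbol\xi_v)-\nabla^r\boldsymbol\phi(\boldsymbol\xi_v)^T\boldsymbol W&\sum_f\boldsymbol\phi(\boldsymbol\xi_f)^T\boldsymbol W_f\mathrm{diag}(\hat{\boldsymbol n}^r_f)\\-\sum_f\boldsymbol W_f\mathrm{diag}(\hat{\boldsymbol n}^r_f)\boldsymbol\phi(\boldsymbol\xi_f)&\boldsymbol 0\end{bmatrix},\qquad \tilde{\boldsymbol Q}+\tilde{\boldsymbol Q}^T=\begin{bmatrix}\boldsymbol 0&\boldsymbol 0\\\boldsymbol 0&\boldsymbol W_f\mathrm{diag}(\hat{\boldsymbol n}^r_f)\end{bmatrix},$$ where rows and columns are indexed by all volume nodes followed by all face nodes (the sums over $f$ in the off-diagonal blocks mean the concatenation over faces). $\odot$ is the Hadamard product in each reference direction followed by summation over the three directions (dot product). $\boldsymbol 1$ is the vector of ones. Metric terms: $\boldsymbol C_m(\boldsymbol\xi)\in\mathbb R^{3\times3}$ is the discrete metric cofactor matrix of element $m$, given at volume and face nodes; the columns of $\boldsymbol C_m$ correspond to reference directions, and the reference flux is $\boldsymbol f^r=\boldsymbol f\boldsymbol C_m$. $\boldsymbol J_m$ is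 the diagonal matrix of the positive Jacobian determinants at the volume nodes. Discrete geometric conservation law: $\sum_{i=1}^3\partial_{\xi^i}\boldsymbol\phi(\boldsymbol\xi_v)\,(\boldsymbol C_m(\boldsymbol\xi_v))_{ni}=\boldsymbol 0$ for $n=1,2,3$, where $(\boldsymbol C_m(\boldsymbol\xi_v))_{ni}$ is the column of nodal values of the $(n,i)$ entry. Surface consistency: $\boldsymbol\phi(\boldsymbol\xi_{fk})\,(\boldsymbol C_m(\boldsymbol\xi_v))_{ni}=(\boldsymbol C_m(\boldsymbol\xi_{fk}))_{ni}$ for all $n,i,f,k$. Fluxes: $\boldsymbol f_s(\cdot,\cdot)$ is a symmetric two-point flux, with $\boldsymbol f_{s,n}\in\mathbb R^{1\times 3}$ for state $n$, and consistency means $\boldsymbol f_{s,n}(\boldsymbol u,\boldsymbol u)=\boldsymbol f_n(\boldsymbol u)$. For all volume and face nodes $i,j$, $(\boldsymbol F^r_{m,n})_{ij}=\boldsymbol f_{s,n}(\tilde{\boldsymbol u}_m(\boldsymbol\xi_i),\tilde{\boldsymbol u}_m(\boldsymbol\xi_j))\,\tfrac12(\boldsymbol C_m(\boldsymbol\xi_i)+\boldsymbol C_m(\boldsymbol\xi_j))$. Here $\tilde{\boldsymbol u}_m(\boldsymbol\xi)=\boldsymbol u(\boldsymbol\chi(\boldsymbol\xi)\hat{\boldsymbol v}^T)$ are the entropy-projected conservative variables, where $\hat{\boldsymbol v}^T=\boldsymbol\Pi\,\boldsymbol v(\boldsymbol\chi(\boldsymbol\xi_v)\hat{\boldsymbol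 u}^T)$, $\boldsymbol\Pi=\boldsymbol M^{-1}\boldsymbol\chi(\boldsymbol\xi_v)^T\boldsymbol W$, $\boldsymbol M=\boldsymbol\chi(\boldsymbol\xi_v)^T\boldsymbol W\boldsymbol\chi(\boldsymbol\xi_v)$. The numerical surface flux is $\boldsymbol f^{*,r}_{m,n}=\boldsymbol f^*_n\boldsymbol C_m(\boldsymbol\xi_{fk})$, where $\boldsymbol f^*_n$ depends on the interior and exterior states at the face node; it is consistent if it equals $\boldsymbol f_n(\boldsymbol u)$ when both states equal $\boldsymbol u$. NSFR discretization with weight-adjusted inverse: for each element $m$ and state $n$, $$\frac{d}{dt}\hat{\boldsymbol u}_{m,n}^T=-\boldsymbol B_m\left\{\left[\boldsymbol\chi(\boldsymbol\xi_v)^T\ \boldsymbol\chi(\boldsymbol\xi_f)^T\right]\left[(\tilde{\boldsymbol Q}-\tilde{\boldsymbol Q}^T)\odot\boldsymbol F^r_{m,n}\right]\boldsymbol 1^T+\sum_{f,k}\boldsymbol\chi(\boldsymbol\xi_{fk})^TW_{fk}\hat{\boldsymbol n}^r_f\cdot\boldsymbol f^{*,r}_{m,n}\right\},$$ $$\boldsymbol B_m=\tilde{\boldsymbol\Pi}(\boldsymbol W\boldsymbol J_m)^{-1}\tilde{\boldsymbol\Pi}^T,\qquad \tilde{\boldsymbol\Pi}=(\boldsymbol M+\boldsymbol K)^{-1}\boldsymbol\chi(\boldsymbol\xi_v)^T\boldsymbol W,$$ where $\boldsymbol K=\sum_{s,v,w}c_{1D}^{(s+v+w)/p}(\boldsymbol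 D_\xi^s\boldsymbol D_\eta^v\boldsymbol D_\zeta^w)^T\boldsymbol M(\boldsymbol D_\xi^s\boldsymbol D_\eta^v\boldsymbol D_\zeta^w)$, the sum is over $s,v,w\in\{0,p\}$ with $s+v+w\ge p$, $\boldsymbol D_\xi=\boldsymbol M^{-1}\boldsymbol\chi(\boldsymbol\xi_v)^T\boldsymbol W\,\partial_\xi\boldsymbol\chi(\boldsymbol\xi_v)$ (similarly $\boldsymbol D_\eta,\boldsymbol D_\zeta$), and $c_{1D}$ is the flux reconstruction correction parameter, such that $\boldsymbol M+\boldsymbol K$ is symmetric positive definite. $\boldsymbol B_m$ is the weight-adjusted approximation of the inverse of the exact modified mass matrix $\boldsymbol M_m+\boldsymbol K_m$ of the curvilinear element. *)

theory Defs
  imports "HOL-Analysis.Analysis" "HOL-Computational_Algebra.Polynomial"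
begin

section \<open>Matrices and partial derivatives\<close>

definition partial :: "'d::finite \<Rightarrow> (real^'d \<Rightarrow> real) \<Rightarrow> real^'d \<Rightarrow> real" where
  "partial i g x = deriv (\<lambda>t. g (x + t *\<^sub>R axis i 1)) 0"

definition diagm :: "('i::finite \<Rightarrow> real) \<Rightarrow> real^'i^'i" where
  "diagm w = (\<chi> i j. if i = j then w i else 0)"

text \<open>The library power on \<^typ>\<open>real^'i^'i\<close> is componentwise, so matrix powers are iterated
  matrix products.\<close>

definition mat_power :: "real^'i^'i \<Rightarrow> nat \<Rightarrow> real^'i::finite^'i" where
  "mat_power A s = (((**) A) ^^ s) (mat 1)"

definition spd :: "real^'i^'i::finite \<Rightarrow> bool" where
  "spd A \<longleftrightarrow> transpose A = A \<and> (\<forall>x. x \<noteq> 0 \<longrightarrow> 0 < x \<bullet> (A *v x))"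

text \<open>Values, and derivatives in direction \<open>i\<close>, of a family of functions: one row per point, one
  column per function.\<close>

definition vals :: "('j \<Rightarrow> real^3 \<Rightarrow> real) \<Rightarrow> ('r \<Rightarrow> real^3) \<Rightarrow> real^'j::finite^'r::finite" where
  "vals g pt = (\<chi> r j. g j (pt r))"

definition partial_vals ::
  "3 \<Rightarrow> ('j \<Rightarrow> real^3 \<Rightarrow> real) \<Rightarrow> ('r \<Rightarrow> real^3) \<Rightarrow> real^'j::finite^'r::finite" where
  "partial_vals i g pt = (\<chi> r j. partial i (g j) (pt r))"


section \<open>Reference element\<close>

text \<open>The finite types \<open>'v\<close>, \<open>'k\<close> and \<open>'b\<close> number the volume nodes, the nodes of one face and the
  basis functions; the six faces are numbered by the type \<open>6\<close>. The volume quadrature is the tensor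
  product, over the three directions, of the rules with node set \<open>grid1d i\<close> and weight
  \<open>weight1d i x\<close> at the node \<open>x\<close>; \<open>vol_node\<close> is an arbitrary numbering of the product grid.\<close>

record ('v, 'k, 'b) reference_element =
  deg :: nat
  basis :: "'b \<Rightarrow> real^3 \<Rightarrow> real"
  grid1d :: "3 \<Rightarrow> real set"
  weight1d :: "3 \<Rightarrow> real \<Rightarrow> real"
  vol_node :: "'v \<Rightarrow> real^3"
  face_node :: "6 \<Rightarrow> 'k \<Rightarrow> real^3"
  face_weight :: "6 \<Rightarrow> 'k \<Rightarrow> real"
  face_normal :: "6 \<Rightarrow> real^3"

definition ref_cube :: "(real^3) set" where
  "ref_cube = {x. \<forall>i. - 1 \<le> x $ i \<and> x $ i \<le> 1}"

definition vol_weight :: "('v, 'k, 'b) reference_element \<Rightarrow> 'v \<Rightarrow> real" where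
  "vol_weight E a = (\<Prod>i\<in>UNIV. weight1d E i (vol_node E a $ i))"

definition tensor_product_quadrature :: "('v::finite, 'k, 'b) reference_element \<Rightarrow> bool" where
  "tensor_product_quadrature E \<longleftrightarrow>
     (\<forall>i. finite (grid1d E i) \<and> grid1d E i \<subseteq> {-1..1}) \<and>
     bij_betw (vol_node E) UNIV {x. \<forall>i. x $ i \<in> grid1d E i} \<and>
     (\<forall>a. 0 < vol_weight E a)"

definition reference_faces :: "('v, 'k, 'b) reference_element \<Rightarrow> bool" where
  "reference_faces E \<longleftrightarrow>
     bij_betw (face_normal E) UNIV {n. \<exists>i. n = axis i 1 \<or> n = - axis i 1} \<and>
     (\<forall>f k. face_node E f k \<in> ref_cube \<and> face_node E f k \<bullet> face_normal E f = 1)"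

definition poly_basis :: "nat \<Rightarrow> (nat \<Rightarrow> real poly) \<Rightarrow> bool" where
  "poly_basis p b \<longleftrightarrow>
     (\<forall>j\<le>p. degree (b j) \<le> p) \<and>
     (\<forall>q. degree q \<le> p \<longrightarrow> (\<exists>c. q = (\<Sum>j\<le>p. smult (c j) (b j)))) \<and>
     (\<forall>c. (\<Sum>j\<le>p. smult (c j) (b j)) = 0 \<longrightarrow> (\<forall>j\<le>p. c j = 0))"

text \<open>The bijection \<open>e\<close> makes the number of basis functions equal to \<open>(p + 1)^3\<close>.\<close>

definition tensor_poly_basis :: "nat \<Rightarrow> ('b::finite \<Rightarrow> real^3 \<Rightarrow> real) \<Rightarrow> bool" where
  "tensor_poly_basis p g \<longleftrightarrow>
     (\<exists>(b :: 3 \<Rightarrow> nat \<Rightarrow> real poly) (e :: 'b \<Rightarrow> nat^3).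
        (\<forall>i. poly_basis p (b i)) \<and>
        bij_betw e UNIV {l. \<forall>i. l $ i \<le> p} \<and>
        (\<forall>j x. g j x = (\<Prod>i\<in>UNIV. poly (b i (e j $ i)) (x $ i))))"

text \<open>The tensor product Lagrange basis collocated on the volume nodes.\<close>

definition lagrange1d :: "real set \<Rightarrow> real \<Rightarrow> real \<Rightarrow> real" where
  "lagrange1d A a t = (\<Prod>b\<in>A - {a}. (t - b) / (a - b))"

definition lagrange :: "('v, 'k, 'b) reference_element \<Rightarrow> 'v \<Rightarrow> real^3 \<Rightarrow> real" where
  "lagrange E a x = (\<Prod>i\<in>UNIV. lagrange1d (grid1d E i) (vol_node E a $ i) (x $ i))"

text \<open>The condition on \<open>card (grid1d E i)\<close> says that the order of the Lagrange basis is at least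
  \<open>deg E\<close> in every variable, that is, that its span contains that of the basis.\<close>

definition valid_reference_element :: "('v::finite, 'k::finite, 'b::finite) reference_element \<Rightarrow> bool"
  where
  "valid_reference_element E \<longleftrightarrow>
     tensor_product_quadrature E \<and> reference_faces E \<and>
     tensor_poly_basis (deg E) (basis E) \<and>
     (\<forall>i. deg E + 1 \<le> card (grid1d E i)) \<and>
     rank (vals (basis E) (vol_node E) :: real^'b^'v) = CARD('b)"


section \<open>Operators on the reference element\<close>

definition weight_mat :: "('v::finite, 'k, 'b) reference_element \<Rightarrow> real^'v^'v" where
  "weight_mat E = diagm (vol_weight E)"

definition vol_deriv :: "('v::finite, 'k, 'b) reference_element \<Rightarrow> 3 \<Rightarrow> real^'v^'v" where
  "vol_deriv E i = partial_vals i (lagrange E) (vol_node E)"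

definition summation_by_parts :: "('v::finite, 'k::finite, 'b) reference_element \<Rightarrow> bool" where
  "summation_by_parts E \<longleftrightarrow> (\<forall>i.
     weight_mat E ** vol_deriv E i + transpose (vol_deriv E i) ** weight_mat E =
     (\<Sum>f\<in>UNIV. transpose (vals (lagrange E) (face_node E f)) **
        diagm (\<lambda>k. face_weight E f k * face_normal E f $ i) ** vals (lagrange E) (face_node E f)))"

text \<open>All nodes: the volume nodes (\<open>Inl\<close>) followed by the face nodes (\<open>Inr\<close>).\<close>

type_synonym ('v, 'k) node = "'v + 6 \<times> 'k"

definition all_nodes :: "('v, 'k, 'b) reference_element \<Rightarrow> ('v, 'k) node \<Rightarrow> real^3" where
  "all_nodes E = case_sum (vol_node E) (\<lambda>(f, k). face_node E f k)"

definition block_mat :: "real^'v^'v \<Rightarrow> real^'w^'v \<Rightarrow> real^'v^'w \<Rightarrow> real^'w^'w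
    \<Rightarrow> real^('v::finite + 'w::finite)^('v + 'w)" where
  "block_mat A B C D = (\<chi> r c. case r of
     Inl a \<Rightarrow> (case c of Inl a' \<Rightarrow> A $ a $ a' | Inr b' \<Rightarrow> B $ a $ b')
   | Inr b \<Rightarrow> (case c of Inl a' \<Rightarrow> C $ b $ a' | Inr b' \<Rightarrow> D $ b $ b'))"

definition face_vals :: "('v::finite, 'k::finite, 'b) reference_element \<Rightarrow> real^'v^(6 \<times> 'k)" where
  "face_vals E = vals (lagrange E) (\<lambda>(f, k). face_node E f k)"

definition face_boundary ::
  "('v, 'k::finite, 'b) reference_element \<Rightarrow> 3 \<Rightarrow> real^(6 \<times> 'k)^(6 \<times> 'k)" where
  "face_boundary E i = diagm (\<lambda>(f, k). face_weight E f k * face_normal E f $ i)"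

definition hybrid_operator :: "('v::finite, 'k::finite, 'b) reference_element
    \<Rightarrow> (3 \<Rightarrow> real^('v, 'k) node^('v, 'k) node) \<Rightarrow> bool" where
  "hybrid_operator E Q \<longleftrightarrow> (\<forall>i.
     Q i - transpose (Q i) =
       block_mat (weight_mat E ** vol_deriv E i - transpose (vol_deriv E i) ** weight_mat E)
                 (transpose (face_vals E) ** face_boundary E i)
                 (- (face_boundary E i ** face_vals E))
                 0 \<and>
     Q i + transpose (Q i) = block_mat 0 0 0 (face_boundary E i))"

definition mass :: "('v::finite, 'k, 'b::finite) reference_element \<Rightarrow> real^'b^'b" where
  "mass E = transpose (vals (basis E) (vol_node E)) ** weight_mat E ** vals (basis E) (vol_node E)"

definition proj :: "('v::finite, 'k, 'b::finite) reference_element \<Rightarrow> real^'v^'b" where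
  "proj E = matrix_inv (mass E) ** transpose (vals (basis E) (vol_node E)) ** weight_mat E"

definition modal_deriv :: "('v::finite, 'k, 'b::finite) reference_element \<Rightarrow> 3 \<Rightarrow> real^'b^'b" where
  "modal_deriv E i = proj E ** partial_vals i (basis E) (vol_node E)"

text \<open>In every summand \<open>s + v + w\<close> is a multiple of \<open>p\<close>, so the exponent of the correction parameter
  \<open>c\<close>, which may be negative, is a natural number and the division is exact (for \<open>p > 0\<close>).\<close>

definition fr_correction :: "('v::finite, 'k, 'b::finite) reference_element \<Rightarrow> real \<Rightarrow> real^'b^'b" where
  "fr_correction E c = (let p = deg E in
     \<Sum>(s, v, w) \<in> {(s, v, w). s \<in> {0, p} \<and> v \<in> {0, p} \<and> w \<in> {0, p} \<and> p \<le> s + v + w}.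
       let D = mat_power (modal_deriv E 1) s ** mat_power (modal_deriv E 2) v
                 ** mat_power (modal_deriv E 3) w
       in c ^ ((s + v + w) div p) *\<^sub>R (transpose D ** mass E ** D))"


section \<open>Conservation law\<close>

text \<open>\<open>f u $ n\<close> is the flux of state \<open>n\<close>, a vector in three-dimensional space. The set \<open>S\<close> is the set of
  admissible states (for the Euler equations, positive density and pressure).\<close>

definition entropy_var :: "(real^'s \<Rightarrow> real) \<Rightarrow> real^'s \<Rightarrow> real^'s::finite" where
  "entropy_var U u = (\<chi> n. partial n U u)"

text \<open>A convex entropy has, by definition, an entropy flux \<open>F\<close> with \<open>F' = v f'\<close> in each space
  direction.\<close>

definition convex_entropy ::
  "(real^'s::finite) set \<Rightarrow> (real^'s \<Rightarrow> real^3^'s) \<Rightarrow> (real^'s \<Rightarrow> real) \<Rightarrow> bool" where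
  "convex_entropy S f U \<longleftrightarrow>
     open S \<and> convex_on S U \<and> (\<forall>u\<in>S. U differentiable (at u)) \<and>
     (\<exists>F :: real^'s \<Rightarrow> real^3. \<forall>u\<in>S. \<forall>i. \<exists>f'.
        ((\<lambda>w. \<chi> n. f w $ n $ i) has_derivative f') (at u) \<and>
        ((\<lambda>w. F w $ i) has_derivative (\<lambda>h. entropy_var U u \<bullet> f' h)) (at u))"

definition symmetric_flux :: "'a set \<Rightarrow> ('a \<Rightarrow> 'a \<Rightarrow> 'c) \<Rightarrow> bool" where
  "symmetric_flux S g \<longleftrightarrow> (\<forall>u\<in>S. \<forall>w\<in>S. g u w = g w u)"

definition consistent_flux :: "'a set \<Rightarrow> ('a \<Rightarrow> 'c) \<Rightarrow> ('a \<Rightarrow> 'a \<Rightarrow> 'c) \<Rightarrow> bool" where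
  "consistent_flux S f g \<longleftrightarrow> (\<forall>u\<in>S. g u u = f u)"


section \<open>Mesh and metric terms\<close>

text \<open>\<open>cofactor m r $ n $ i\<close> is the entry of the metric cofactor matrix at the node \<open>r\<close> for physical
  direction \<open>n\<close> (row) and reference direction \<open>i\<close> (column). \<open>neighbour m f k\<close> is the face node of the
  adjacent element that coincides with the face node \<open>(f, k)\<close> of \<open>m\<close>, and \<open>None\<close> on the boundary of
  the domain.\<close>

record ('m, 'v, 'k) mesh =
  cofactor :: "'m \<Rightarrow> ('v, 'k) node \<Rightarrow> real^3^3"
  jac_det :: "'m \<Rightarrow> 'v \<Rightarrow> real"
  neighbour :: "'m \<Rightarrow> 6 \<Rightarrow> 'k \<Rightarrow> ('m \<times> 6 \<times> 'k) option"

definition discrete_gcl ::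
  "('v::finite, 'k, 'b) reference_element \<Rightarrow> ('m, 'v, 'k) mesh \<Rightarrow> bool" where
  "discrete_gcl E G \<longleftrightarrow>
     (\<forall>m n. (\<Sum>i\<in>UNIV. vol_deriv E i *v (\<chi> a. cofactor G m (Inl a) $ n $ i)) = 0)"

definition surface_metric_consistency ::
  "('v::finite, 'k, 'b) reference_element \<Rightarrow> ('m, 'v, 'k) mesh \<Rightarrow> bool" where
  "surface_metric_consistency E G \<longleftrightarrow>
     (\<forall>m n i f k. (\<Sum>a\<in>UNIV. lagrange E a (face_node E f k) * cofactor G m (Inl a) $ n $ i)
        = cofactor G m (Inr (f, k)) $ n $ i)"


section \<open>The NSFR discretization\<close>

text \<open>The coefficients of element \<open>m\<close> are \<open>u m :: real^'b^'s\<close>, with one row \<open>u m $ n\<close> per state \<open>n\<close>.\<close>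

definition eval_modal ::
  "('v, 'k, 'b::finite) reference_element \<Rightarrow> real^'b^'s::finite \<Rightarrow> real^3 \<Rightarrow> real^'s" where
  "eval_modal E c x = (\<chi> n. \<Sum>j\<in>UNIV. basis E j x * c $ n $ j)"

definition entropy_coeffs :: "('v::finite, 'k, 'b::finite) reference_element
    \<Rightarrow> (real^'s \<Rightarrow> real) \<Rightarrow> real^'b^'s \<Rightarrow> real^'b^'s::finite" where
  "entropy_coeffs E U c =
     (\<chi> n. proj E *v (\<chi> a. entropy_var U (eval_modal E c (vol_node E a)) $ n))"

definition entropy_projected :: "('v::finite, 'k, 'b::finite) reference_element
    \<Rightarrow> (real^'s) set \<Rightarrow> (real^'s \<Rightarrow> real) \<Rightarrow> real^'b^'s \<Rightarrow> real^3 \<Rightarrow> real^'s::finite" where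
  "entropy_projected E S U c x =
     inv_into S (entropy_var U) (eval_modal E (entropy_coeffs E U c) x)"

text \<open>\<open>two_point_flux E S U G fs u m n r r'\<close> is the entry of the two-point reference flux matrix of
  element \<open>m\<close> and state \<open>n\<close> at the pair of nodes \<open>(r, r')\<close>, a vector indexed by the reference
  directions.\<close>

definition two_point_flux :: "('v::finite, 'k, 'b::finite) reference_element
    \<Rightarrow> (real^'s::finite) set \<Rightarrow> (real^'s \<Rightarrow> real) \<Rightarrow> ('m, 'v, 'k) mesh
    \<Rightarrow> (real^'s \<Rightarrow> real^'s \<Rightarrow> real^3^'s) \<Rightarrow> ('m \<Rightarrow> real^'b^'s) \<Rightarrow> 'm \<Rightarrow> 's
    \<Rightarrow> ('v, 'k) node \<Rightarrow> ('v, 'k) node \<Rightarrow> real^3" where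
  "two_point_flux E S U G fs u m n r r' =
     (fs (entropy_projected E S U (u m) (all_nodes E r))
         (entropy_projected E S U (u m) (all_nodes E r')) $ n)
       v* ((1/2) *\<^sub>R (cofactor G m r + cofactor G m r'))"

definition hadamard_dot :: "(3 \<Rightarrow> real^'r^'r) \<Rightarrow> ('r \<Rightarrow> 'r \<Rightarrow> real^3) \<Rightarrow> real^'r::finite^'r" where
  "hadamard_dot A F = (\<chi> r r'. \<Sum>i\<in>UNIV. A i $ r $ r' * F r r' $ i)"

definition volume_term :: "('v::finite, 'k::finite, 'b::finite) reference_element
    \<Rightarrow> (3 \<Rightarrow> real^('v, 'k) node^('v, 'k) node)
    \<Rightarrow> (('v, 'k) node \<Rightarrow> ('v, 'k) node \<Rightarrow> real^3) \<Rightarrow> real^'b" where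
  "volume_term E Q F =
     transpose (vals (basis E) (all_nodes E)) *v
       (hadamard_dot (\<lambda>i. Q i - transpose (Q i)) F *v 1)"

text \<open>The surface term for a reference flux \<open>g f k\<close> at the face nodes.\<close>

definition surface_term :: "('v, 'k::finite, 'b::finite) reference_element
    \<Rightarrow> (6 \<Rightarrow> 'k \<Rightarrow> real^3) \<Rightarrow> real^'b" where
  "surface_term E g = (\<Sum>f\<in>UNIV. \<Sum>k\<in>UNIV.
     (face_weight E f k * (face_normal E f \<bullet> g f k)) *\<^sub>R (\<chi> j. basis E j (face_node E f k)))"

text \<open>\<open>ub\<close> is the boundary data.\<close>

definition exterior_state :: "('v::finite, 'k, 'b::finite) reference_element
    \<Rightarrow> (real^'s::finite) set \<Rightarrow> (real^'s \<Rightarrow> real) \<Rightarrow> ('m, 'v, 'k) mesh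
    \<Rightarrow> ('m \<Rightarrow> 6 \<Rightarrow> 'k \<Rightarrow> real^'s) \<Rightarrow> ('m \<Rightarrow> real^'b^'s) \<Rightarrow> 'm \<Rightarrow> 6 \<Rightarrow> 'k \<Rightarrow> real^'s" where
  "exterior_state E S U G ub u m f k = (case neighbour G m f k of
     None \<Rightarrow> ub m f k
   | Some (m', f', k') \<Rightarrow> entropy_projected E S U (u m') (face_node E f' k'))"

text \<open>The numerical flux \<open>fstar m f k\<close> may depend on the face node (for instance through the
  physical normal), besides the interior and the exterior state.\<close>

definition numerical_flux :: "('v::finite, 'k, 'b::finite) reference_element
    \<Rightarrow> (real^'s::finite) set \<Rightarrow> (real^'s \<Rightarrow> real) \<Rightarrow> ('m, 'v, 'k) mesh
    \<Rightarrow> ('m \<Rightarrow> 6 \<Rightarrow> 'k \<Rightarrow> real^'s \<Rightarrow> real^'s \<Rightarrow> real^3^'s)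
    \<Rightarrow> ('m \<Rightarrow> 6 \<Rightarrow> 'k \<Rightarrow> real^'s) \<Rightarrow> ('m \<Rightarrow> real^'b^'s) \<Rightarrow> 'm \<Rightarrow> 's \<Rightarrow> 6 \<Rightarrow> 'k \<Rightarrow> real^3" where
  "numerical_flux E S U G fstar ub u m n f k =
     (fstar m f k (entropy_projected E S U (u m) (face_node E f k))
                  (exterior_state E S U G ub u m f k) $ n)
       v* cofactor G m (Inr (f, k))"

definition weight_adjusted_proj ::
  "('v::finite, 'k, 'b::finite) reference_element \<Rightarrow> real \<Rightarrow> real^'v^'b" where
  "weight_adjusted_proj E c =
     matrix_inv (mass E + fr_correction E c)
       ** transpose (vals (basis E) (vol_node E)) ** weight_mat E"

definition weight_adjusted_inverse :: "('v::finite, 'k, 'b::finite) reference_element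
    \<Rightarrow> real \<Rightarrow> ('m, 'v, 'k) mesh \<Rightarrow> 'm \<Rightarrow> real^'b^'b" where
  "weight_adjusted_inverse E c G m =
     weight_adjusted_proj E c ** matrix_inv (weight_mat E ** diagm (jac_det G m))
       ** transpose (weight_adjusted_proj E c)"

definition nsfr_rhs :: "('v::finite, 'k::finite, 'b::finite) reference_element
    \<Rightarrow> (3 \<Rightarrow> real^('v, 'k) node^('v, 'k) node) \<Rightarrow> real
    \<Rightarrow> (real^'s::finite) set \<Rightarrow> (real^'s \<Rightarrow> real) \<Rightarrow> ('m, 'v, 'k) mesh
    \<Rightarrow> (real^'s \<Rightarrow> real^'s \<Rightarrow> real^3^'s)
    \<Rightarrow> ('m \<Rightarrow> 6 \<Rightarrow> 'k \<Rightarrow> real^'s \<Rightarrow> real^'s \<Rightarrow> real^3^'s)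
    \<Rightarrow> ('m \<Rightarrow> 6 \<Rightarrow> 'k \<Rightarrow> real^'s) \<Rightarrow> ('m \<Rightarrow> real^'b^'s) \<Rightarrow> 'm \<Rightarrow> 's \<Rightarrow> real^'b" where
  "nsfr_rhs E Q c S U G fs fstar ub u m n =
     - (weight_adjusted_inverse E c G m *v
          (volume_term E Q (two_point_flux E S U G fs u m n)
           + surface_term E (numerical_flux E S U G fstar ub u m n)))"

text \<open>\<open>u\<close> solves the semi-discrete equations on the time set \<open>T\<close>.\<close>

definition nsfr_solution :: "('v::finite, 'k::finite, 'b::finite) reference_element
    \<Rightarrow> (3 \<Rightarrow> real^('v, 'k) node^('v, 'k) node) \<Rightarrow> real
    \<Rightarrow> (real^'s::finite) set \<Rightarrow> (real^'s \<Rightarrow> real) \<Rightarrow> ('m, 'v, 'k) mesh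
    \<Rightarrow> (real^'s \<Rightarrow> real^'s \<Rightarrow> real^3^'s)
    \<Rightarrow> ('m \<Rightarrow> 6 \<Rightarrow> 'k \<Rightarrow> real^'s \<Rightarrow> real^'s \<Rightarrow> real^3^'s)
    \<Rightarrow> (real \<Rightarrow> 'm \<Rightarrow> 6 \<Rightarrow> 'k \<Rightarrow> real^'s) \<Rightarrow> real set \<Rightarrow> (real \<Rightarrow> 'm \<Rightarrow> real^'b^'s) \<Rightarrow> bool" where
  "nsfr_solution E Q c S U G fs fstar ub T u \<longleftrightarrow>
     (\<forall>t\<in>T. \<forall>m n. ((\<lambda>\<tau>. u \<tau> m $ n) has_vector_derivative
        nsfr_rhs E Q c S U G fs fstar (ub t) (u t) m n) (at t within T))"

definition free_stream :: "('v, 'k, 'b::finite) reference_element \<Rightarrow> ('m, 'v, 'k) mesh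
    \<Rightarrow> ('m \<Rightarrow> 6 \<Rightarrow> 'k \<Rightarrow> real^'s::finite) \<Rightarrow> ('m \<Rightarrow> real^'b^'s) \<Rightarrow> real^'s \<Rightarrow> bool" where
  "free_stream E G ub u u\<^sub>0 \<longleftrightarrow>
     (\<forall>m. \<forall>x\<in>ref_cube. eval_modal E (u m) x = u\<^sub>0) \<and>
     (\<forall>m f k. neighbour G m f k = None \<longrightarrow> ub m f k = u\<^sub>0)"

end

theory Submission
  imports Defs
begin

text \<open>On a constant state the entropy projection is exact, since the basis spans the constants, so
  the two-point flux is the constant flux times an average of metric terms. The average splits
  \<open>(Q - Q\<^sup>T) \<odot> F\<close> into \<open>(Q - Q\<^sup>T) 1\<close>, weighted by the metric terms, and \<open>Q - Q\<^sup>T\<close>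
  applied to the metric terms. By summation by parts and surface consistency, in the volume rows the
  former vanishes and the latter is \<open>2 W D C\<close>, which the discrete geometric conservation law sums to
  zero; in the face rows both are \<open>- B C\<close>, where \<open>B\<close> holds the face weights times the normals,
  and the surface flux cancels their mean.\<close>

section \<open>Tensor product sums and the Lagrange partition of unity\<close>

text \<open>Serves two numberings of a box: the volume nodes by the product grid and the basis
  functions by multi-indices.\<close>

lemma sum_bij_prod:
  fixes g :: "'a::finite \<Rightarrow> 'c^'d::finite" and h :: "'d \<Rightarrow> 'c \<Rightarrow> real"
  assumes bij: "bij_betw g UNIV {x. \<forall>i. x $ i \<in> A i}" and fin: "\<And>i. finite (A i)"
  shows "(\<Sum>a\<in>UNIV. \<Prod>i\<in>UNIV. h i (g a $ i)) = (\<Prod>i\<in>UNIV. \<Sum>t\<in>A i. h i t)"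
proof -
  have "(\<Sum>a\<in>UNIV. \<Prod>i\<in>UNIV. h i (g a $ i))
      = (\<Sum>x\<in>{x. \<forall>i. x $ i \<in> A i}. \<Prod>i\<in>UNIV. h i (x $ i))"
    by (rule sum.reindex_bij_betw[OF bij])
  also have "\<dots> = (\<Sum>x\<in>PiE UNIV A. \<Prod>i\<in>UNIV. h i (x i))"
    by (rule sum.reindex_bij_witness[where i = vec_lambda and j = vec_nth]) auto
  also have "\<dots> = (\<Prod>i\<in>UNIV. \<Sum>t\<in>A i. h i t)"
    by (rule prod_sum_PiE[symmetric]) (auto simp: fin)
  finally show ?thesis .
qed

text \<open>The sum takes the value 1 at the \<open>card A\<close> nodes and has smaller degree, so
  it is the polynomial 1.\<close>

lemma sum_lagrange1d:
  assumes fin: "finite A" and ne: "A \<noteq> {}"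
  shows "(\<Sum>a\<in>A. lagrange1d A a t) = 1"
proof -
  define P where "P a = (\<Prod>b\<in>A - {a}. smult (inverse (a - b)) [:- b, 1:])" for a
  have poly_P: "poly (P a) x = lagrange1d A a x" for a x
    by (simp add: P_def poly_prod lagrange1d_def divide_inverse left_diff_distrib mult.commute)
  have "degree (P a) \<le> card A - 1" if "a \<in> A" for a
  proof -
    have "degree (P a) \<le> (\<Sum>b\<in>A - {a}. degree (smult (inverse (a - b)) [:- b, 1:]))"
      unfolding P_def by (rule degree_prod_sum_le[unfolded o_def]) (use fin in auto)
    also have "\<dots> \<le> (\<Sum>b\<in>A - {a}. 1)"
      by (rule sum_mono) simp
    finally show ?thesis
      using that fin by simp
  qed
  then have "degree (\<Sum>a\<in>A. P a) \<le> card A - 1"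
    by (intro degree_sum_le fin)
  \<comment> \<open>Without a node the truncated bound \<open>card A - 1\<close> would not give a
    strict inequality.\<close>
  moreover have "0 < card A"
    using fin ne by (simp add: card_gt_0_iff)
  ultimately have deg: "degree (\<Sum>a\<in>A. P a) < card A"
    by linarith
  have "poly (\<Sum>a\<in>A. P a) x = poly 1 x" if "x \<in> A" for x
  proof -
    \<comment> \<open>For \<open>a \<noteq> x\<close> the factor with \<open>b = x\<close>
      vanishes.\<close>
    have "lagrange1d A a x = (if a = x then 1 else 0)" if "a \<in> A" for a
    proof (cases "a = x")
      case True
      then show ?thesis by (auto simp: lagrange1d_def intro!: prod.neutral)
    next
      case False
      then show ?thesis
        using \<open>x \<in> A\<close> fin by (auto simp: lagrange1d_def)
    qed
    then show ?thesis
      using that fin by (simp add: poly_sum poly_P)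
  qed
  then have "(\<Sum>a\<in>A. P a) = 1"
    by (rule poly_eqI_degree[of A]) (use deg \<open>0 < card A\<close> in auto)
  then have "poly (\<Sum>a\<in>A. P a) t = 1"
    by simp
  then show ?thesis
    by (simp add: poly_sum poly_P)
qed

lemma sum_lagrange:
  assumes "valid_reference_element E"
  shows "(\<Sum>a\<in>UNIV. lagrange E a x) = 1"
proof -
  have fin: "finite (grid1d E i)" and ne: "grid1d E i \<noteq> {}" for i
    using assms by (auto simp: valid_reference_element_def tensor_product_quadrature_def
        dest: spec[of _ i])
  have bij: "bij_betw (vol_node E) UNIV {x. \<forall>i. x $ i \<in> grid1d E i}"
    using assms by (simp add: valid_reference_element_def tensor_product_quadrature_def)
  show ?thesis
    unfolding lagrange_def
    by (subst sum_bij_prod[OF bij fin]) (simp add: sum_lagrange1d fin ne)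
qed

text \<open>Lets \<open>deriv\<close> distribute over the sum of the Lagrange functions; along a
  line each of them is a polynomial in the parameter.\<close>

lemma lagrange_line_differentiable:
  "(\<lambda>t. lagrange E a (x + t *\<^sub>R y)) field_differentiable (at s)"
proof -
  have "(\<lambda>t. lagrange E a (x + t *\<^sub>R y)) differentiable (at s)"
    unfolding lagrange_def lagrange1d_def differentiable_def
    by (intro exI) (rule derivative_eq_intros has_derivative_prod refl | simp)+
  then show ?thesis
    by (simp add: real_differentiable_def field_differentiable_def)
qed

text \<open>Differentiate the partition of unity \<open>sum_lagrange\<close>.\<close>

lemma vol_deriv_one:
  assumes "valid_reference_element E"
  shows "vol_deriv E i *v 1 = 0"
proof -
  have "(\<Sum>a\<in>UNIV. partial i (lagrange E a) x) = partial i (\<lambda>x. \<Sum>a\<in>UNIV. lagrange E a x) x" for x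
    unfolding partial_def
    by (simp add: lagrange_line_differentiable)
  also have "\<dots> x = 0" for x
    by (simp add: sum_lagrange[OF assms] partial_def)
  finally show ?thesis
    by (simp add: vec_eq_iff matrix_vector_mult_def vol_deriv_def partial_vals_def)
qed

lemma face_vals_one:
  assumes "valid_reference_element E"
  shows "face_vals E *v 1 = 1"
  by (simp add: vec_eq_iff matrix_vector_mult_def face_vals_def vals_def sum_lagrange[OF assms])

section \<open>Matrix algebra and the hybrid operator\<close>

lemma matrix_vector_mult_uminus: "(- A) *v x = - (A *v x)" for A :: "real^'c::finite^'r"
  by (simp add: vec_eq_iff matrix_vector_mult_def sum_negf)

lemma diagm_mult_vec: "diagm w *v x = (\<chi> r. w r * x $ r)"
  by (simp add: vec_eq_iff matrix_vector_mult_def diagm_def if_distrib[of "\<lambda>c. c * _"] cong: if_cong)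

lemma sum_UNIV_Plus:
  "(\<Sum>r\<in>UNIV. h r) = (\<Sum>a\<in>UNIV. h (Inl a)) + (\<Sum>b\<in>UNIV. h (Inr b))"
  for h :: "'a::finite + 'b::finite \<Rightarrow> 'c::comm_monoid_add"
  by (subst UNIV_Plus_UNIV[symmetric], subst sum.Plus) simp_all

lemma block_mat_mult_vec:
  "block_mat A B C D *v x = (\<chi> r. case r of
     Inl a \<Rightarrow> (A *v (\<chi> a. x $ Inl a) + B *v (\<chi> b. x $ Inr b)) $ a
   | Inr b \<Rightarrow> (C *v (\<chi> a. x $ Inl a) + D *v (\<chi> b. x $ Inr b)) $ b)"
  by (simp add: vec_eq_iff matrix_vector_mult_def block_mat_def sum_UNIV_Plus split: sum.split)

text \<open>As the boundary matrix is diagonal, each entry of the right-hand side is a single sum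
  over pairs of a face and a node, which regroups face by face.\<close>

lemma summation_by_parts_stacked:
  assumes "summation_by_parts E"
  shows "weight_mat E ** vol_deriv E i + transpose (vol_deriv E i) ** weight_mat E
    = transpose (face_vals E) ** face_boundary E i ** face_vals E"
proof -
  have diag: "(A ** diagm w ** B) $ r $ s = (\<Sum>k\<in>UNIV. A $ r $ k * w k * B $ k $ s)"
    for A :: "real^'i::finite^'r::finite" and w and B :: "real^'s::finite^'i" and r s
    by (simp add: matrix_matrix_mult_def diagm_def if_distrib[of "\<lambda>c. _ * c"] cong: if_cong)
  show ?thesis
    using assms unfolding summation_by_parts_def face_boundary_def
    by (simp add: vec_eq_iff diag transpose_def face_vals_def vals_def
        sum.cartesian_product split_def)
qed

text \<open>With \<open>R\<close> for \<open>face_vals E\<close>, summation by parts turns the volume block into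
  \<open>2 W D - R\<^sup>T B R\<close>, whose boundary part cancels against the off-diagonal block \<open>R\<^sup>T B\<close>
  when the face values of \<open>x\<close> are interpolated from its volume values.\<close>

lemma hybrid_operator_mult_vec:
  assumes "summation_by_parts E" "hybrid_operator E Q"
    and trace: "face_vals E *v (\<chi> a. x $ Inl a) = (\<chi> q. x $ Inr q)"
  shows "(Q i - transpose (Q i)) *v x = (\<chi> r. case r of
     Inl a \<Rightarrow> 2 * vol_weight E a * (vol_deriv E i *v (\<chi> a. x $ Inl a)) $ a
   | Inr (l, k) \<Rightarrow> - (face_weight E l k * face_normal E l $ i * x $ Inr (l, k)))"
proof -
  let ?W = "weight_mat E" and ?D = "vol_deriv E i" and ?R = "face_vals E" and ?B = "face_boundary E i"
  let ?v = "\<chi> a. x $ Inl a" and ?q = "\<chi> q. x $ Inr q"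
  have Q: "Q i - transpose (Q i) =
      block_mat (?W ** ?D - transpose ?D ** ?W) (transpose ?R ** ?B) (- (?B ** ?R)) 0"
    using assms(2) by (simp add: hybrid_operator_def)
  have "?W ** ?D - transpose ?D ** ?W = ?W ** ?D + ?W ** ?D - transpose ?R ** ?B ** ?R"
    by (simp add: summation_by_parts_stacked[OF assms(1), symmetric])
  then have "(?W ** ?D - transpose ?D ** ?W) *v ?v + (transpose ?R ** ?B) *v ?q
      = ?W *v (?D *v ?v) + ?W *v (?D *v ?v)"
    by (simp only: matrix_vector_mult_diff_rdistrib matrix_vector_mult_add_rdistrib
        matrix_vector_mul_assoc[symmetric] trace diff_add_cancel)
  moreover have "- (?B ** ?R) *v ?v + 0 *v ?q = - (?B *v ?q)"
    by (simp add: matrix_vector_mul_assoc[symmetric] trace matrix_vector_mult_uminus)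
  ultimately show ?thesis
    unfolding Q block_mat_mult_vec
    by (auto simp: vec_eq_iff weight_mat_def face_boundary_def diagm_mult_vec split: sum.split)
qed

section \<open>Residual of a constant physical flux\<close>

text \<open>The flux is linear in the metric matrix: the half taken at the row node leaves the sum
  over columns and multiplies a row sum, the half at the column node stays under
  \<open>A i\<close>.\<close>

lemma hadamard_dot_average_one:
  fixes C :: "'r::finite \<Rightarrow> real^3^3"
  shows "(hadamard_dot A (\<lambda>r r'. \<beta> v* ((1/2) *\<^sub>R (C r + C r'))) *v 1) $ r
    = (\<Sum>i\<in>UNIV. ((\<beta> v* C r) $ i * (A i *v 1) $ r + (A i *v (\<chi> r'. (\<beta> v* C r') $ i)) $ r) / 2)"
proof -
  have avg: "(\<beta> v* ((1/2) *\<^sub>R (C r + C r'))) $ i = ((\<beta> v* C r) $ i + (\<beta> v* C r') $ i) / 2" for r' i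
    by (simp add: vector_matrix_mult_def sum.distrib[symmetric] sum_divide_distrib algebra_simps
        add_divide_distrib)
  have "(hadamard_dot A (\<lambda>r r'. \<beta> v* ((1/2) *\<^sub>R (C r + C r'))) *v 1) $ r
    = (\<Sum>r'\<in>UNIV. \<Sum>i\<in>UNIV. A i $ r $ r' * (((\<beta> v* C r) $ i + (\<beta> v* C r') $ i) / 2))"
    by (simp add: matrix_vector_mult_def hadamard_dot_def avg)
  also have "\<dots> = (\<Sum>i\<in>UNIV. \<Sum>r'\<in>UNIV. A i $ r $ r' * (((\<beta> v* C r) $ i + (\<beta> v* C r') $ i) / 2))"
    by (rule sum.swap)
  also have "\<dots> = (\<Sum>i\<in>UNIV. ((\<beta> v* C r) $ i * (A i *v 1) $ r + (A i *v (\<chi> r'. (\<beta> v* C r') $ i)) $ r) / 2)"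
    by (rule sum.cong[OF refl])
      (simp add: matrix_vector_mult_def sum_distrib_left sum.distrib[symmetric] sum_divide_distrib
        algebra_simps)
  finally show ?thesis .
qed

lemma constant_flux_residual:
  assumes valid: "valid_reference_element E" and sbp: "summation_by_parts E"
    and hyb: "hybrid_operator E Q"
    and gcl: "discrete_gcl E G" and surf: "surface_metric_consistency E G"
  shows "volume_term E Q (\<lambda>r r'. \<beta> v* ((1/2) *\<^sub>R (cofactor G m r + cofactor G m r')))
    + surface_term E (\<lambda>l k. \<beta> v* cofactor G m (Inr (l, k))) = 0"
proof -
  let ?C = "cofactor G m" and ?A = "\<lambda>i. Q i - transpose (Q i)"
  let ?g = "\<lambda>i. \<chi> r. (\<beta> v* ?C r) $ i"
  let ?H = "hadamard_dot ?A (\<lambda>r r'. \<beta> v* ((1/2) *\<^sub>R (?C r + ?C r'))) *v 1"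
  have one: "(\<chi> r. 1) = (1 :: real^'z)" by (simp add: vec_eq_iff)
  \<comment> \<open>The vector 1 is interpolated exactly to the faces and has zero
    derivative.\<close>
  have A_one: "?A i *v 1 = (\<chi> r. case r of Inl a \<Rightarrow> 0
      | Inr (l, k) \<Rightarrow> - (face_weight E l k * face_normal E l $ i))" for i
    by (subst hybrid_operator_mult_vec[OF sbp hyb])
      (auto simp: vec_eq_iff one face_vals_one[OF valid] vol_deriv_one[OF valid] split: sum.split)
  \<comment> \<open>Surface consistency holds entrywise, hence for the combination over physical
    directions with coefficients \<open>\<beta> $ n\<close>.\<close>
  have trace: "face_vals E *v (\<chi> a. ?g i $ Inl a) = (\<chi> q. ?g i $ Inr q)" for i
  proof -
    have "(\<Sum>a\<in>UNIV. lagrange E a (face_node E l k) * (\<Sum>n\<in>UNIV. \<beta> $ n * ?C (Inl a) $ n $ i))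
        = (\<Sum>n\<in>UNIV. \<beta> $ n * ?C (Inr (l, k)) $ n $ i)" for l k
    proof -
      have "(\<Sum>a\<in>UNIV. lagrange E a (face_node E l k) * (\<Sum>n\<in>UNIV. \<beta> $ n * ?C (Inl a) $ n $ i))
        = (\<Sum>n\<in>UNIV. \<beta> $ n * (\<Sum>a\<in>UNIV. lagrange E a (face_node E l k) * ?C (Inl a) $ n $ i))"
        by (simp add: sum_distrib_left mult.left_commute) (rule sum.swap)
      then show ?thesis
        using surf by (simp add: surface_metric_consistency_def)
    qed
    then show ?thesis
      by (auto simp: vec_eq_iff matrix_vector_mult_def face_vals_def vals_def vector_matrix_mult_def
          mult.commute)
  qed
  \<comment> \<open>The same combination of the conservation laws for the three physical
    directions.\<close>
  have gcl': "(\<Sum>i\<in>UNIV. (vol_deriv E i *v (\<chi> a. ?g i $ Inl a)) $ a) = 0" for a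
  proof -
    have comb: "(\<chi> a. ?g i $ Inl a) = (\<Sum>n\<in>UNIV. \<beta> $ n *\<^sub>R (\<chi> a. ?C (Inl a) $ n $ i))" for i
      by (simp add: vec_eq_iff vector_matrix_mult_def mult.commute)
    have "(\<Sum>i\<in>UNIV. vol_deriv E i *v (\<chi> a. ?g i $ Inl a))
        = (\<Sum>n\<in>UNIV. \<beta> $ n *\<^sub>R (\<Sum>i\<in>UNIV. vol_deriv E i *v (\<chi> a. ?C (Inl a) $ n $ i)))"
      unfolding comb
      by (simp add: linear_sum[OF matrix_vector_mul_linear] matrix_vector_mult_scaleR
          scaleR_sum_right) (rule sum.swap)
    also have "\<dots> = 0"
      using gcl by (simp add: discrete_gcl_def)
    finally show ?thesis
      by (simp add: vec_eq_iff)
  qed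
  have H_vol: "?H $ Inl a = 0" for a
  proof -
    \<comment> \<open>The factor 1/2 of the average cancels the 2 from summation by parts.\<close>
    have "?H $ Inl a = (\<Sum>i\<in>UNIV. vol_weight E a * (vol_deriv E i *v (\<chi> a. ?g i $ Inl a)) $ a)"
      unfolding hadamard_dot_average_one A_one hybrid_operator_mult_vec[OF sbp hyb trace] by simp
    then show ?thesis
      by (simp only: sum_distrib_left[symmetric] gcl')
  qed
  have H_face: "?H $ Inr (l, k) = - (face_weight E l k * (face_normal E l \<bullet> (\<beta> v* ?C (Inr (l, k)))))" for l k
    unfolding hadamard_dot_average_one A_one hybrid_operator_mult_vec[OF sbp hyb trace]
    by (simp add: inner_vec_def sum_distrib_left sum_negf[symmetric] algebra_simps)
  \<comment> \<open>Only the face rows survive, and testing them with the basis gives the negative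
    surface term.\<close>
  have "volume_term E Q (\<lambda>r r'. \<beta> v* ((1/2) *\<^sub>R (?C r + ?C r'))) $ j
      = - surface_term E (\<lambda>l k. \<beta> v* ?C (Inr (l, k))) $ j" for j
  proof -
    have "volume_term E Q (\<lambda>r r'. \<beta> v* ((1/2) *\<^sub>R (?C r + ?C r'))) $ j
        = (\<Sum>r\<in>UNIV. basis E j (all_nodes E r) * ?H $ r)"
      unfolding volume_term_def by (subst matrix_vector_mult_def) (simp add: transpose_def vals_def)
    also have "\<dots> = (\<Sum>(l, k)\<in>UNIV. basis E j (face_node E l k) * ?H $ Inr (l, k))"
      by (simp only: sum_UNIV_Plus H_vol) (simp add: all_nodes_def split_def)
    also have "\<dots> = - surface_term E (\<lambda>l k. \<beta> v* ?C (Inr (l, k))) $ j"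
      unfolding H_face
      by (simp add: surface_term_def sum.cartesian_product sum_negf[symmetric] split_def mult.commute)
    finally show ?thesis .
  qed
  then show ?thesis
    by (simp add: vec_eq_iff)
qed

section \<open>Entropy projection of a constant state\<close>

text \<open>In each direction the polynomial 1 has coefficients \<open>c i\<close>; their products
  over the directions are the coefficients of the constant.\<close>

lemma basis_represents_one:
  assumes "valid_reference_element E"
  obtains w where "\<And>x. (\<Sum>j\<in>UNIV. basis E j x * w $ j) = 1"
proof -
  obtain b :: "3 \<Rightarrow> nat \<Rightarrow> real poly" and e :: "_ \<Rightarrow> nat^3"
    where b: "\<And>i. poly_basis (deg E) (b i)"
      and bij: "bij_betw e UNIV {l. \<forall>i. l $ i \<in> {..deg E}}"
      and basis: "\<And>j x. basis E j x = (\<Prod>i\<in>UNIV. poly (b i (e j $ i)) (x $ i))"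
    using assms by (auto simp: valid_reference_element_def tensor_poly_basis_def)
  have "\<exists>c. 1 = (\<Sum>j\<le>deg E. smult (c j) (b i j))" for i
    using b[of i] unfolding poly_basis_def by (metis degree_1 le0)
  then obtain c where c: "\<And>i. 1 = (\<Sum>j\<le>deg E. smult (c i j) (b i j))"
    by metis
  have c': "(\<Sum>j\<le>deg E. poly (b i j) y * c i j) = 1" for i y
  proof -
    have "poly 1 y = poly (\<Sum>j\<le>deg E. smult (c i j) (b i j)) y"
      using c by simp
    then show ?thesis
      by (simp add: poly_sum mult.commute)
  qed
  show ?thesis
  proof
    fix x
    show "(\<Sum>j\<in>UNIV. basis E j x * (\<chi> j. \<Prod>i\<in>UNIV. c i (e j $ i)) $ j) = 1"
      using sum_bij_prod[OF bij, where h = "\<lambda>i n. poly (b i n) (x $ i) * c i n"]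
      by (simp add: basis prod.distrib c')
  qed
qed

text \<open>The quadratic form is a positively weighted sum of squared nodal values, so a kernel
  vector has zero nodal values, and full column rank makes it zero.\<close>

lemma invertible_mass:
  assumes "valid_reference_element E"
  shows "invertible (mass E)"
proof -
  let ?V = "vals (basis E) (vol_node E)"
  have pos: "0 < vol_weight E a" for a
    using assms by (simp add: valid_reference_element_def tensor_product_quadrature_def)
  have inj: "inj ((*v) ?V)"
    using assms by (simp add: valid_reference_element_def full_rank_injective)
  have "x = 0" if "mass E *v x = 0" for x
  proof -
    have "0 = x \<bullet> (mass E *v x)"
      using that by simp
    also have "\<dots> = (?V *v x) \<bullet> (weight_mat E *v (?V *v x))"
      unfolding mass_def matrix_vector_mul_assoc[symmetric]
      by (metis dot_lmul_matrix inner_commute transpose_matrix_vector)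
    also have "\<dots> = (\<Sum>a\<in>UNIV. vol_weight E a * ((?V *v x) $ a)\<^sup>2)"
      by (simp add: inner_vec_def weight_mat_def diagm_mult_vec power2_eq_square algebra_simps)
    finally have "\<forall>a\<in>UNIV. vol_weight E a * ((?V *v x) $ a)\<^sup>2 = 0"
      by (subst (asm) eq_commute, subst (asm) sum_nonneg_eq_0_iff)
        (auto intro: mult_nonneg_nonneg less_imp_le[OF pos])
    then have "?V *v x = ?V *v 0"
      using pos by (simp add: vec_eq_iff less_imp_neq[symmetric])
    then show ?thesis
      using inj by (blast dest: injD)
  qed
  then show ?thesis
    by (simp add: invertible_left_inverse matrix_left_invertible_ker)
qed

lemma proj_vals:
  assumes "valid_reference_element E"
  shows "proj E *v (vals (basis E) (vol_node E) *v w) = w"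
proof -
  have "proj E *v (vals (basis E) (vol_node E) *v w) = (matrix_inv (mass E) ** mass E) *v w"
    by (simp add: proj_def mass_def matrix_vector_mul_assoc matrix_mul_assoc)
  \<comment> \<open>\<open>matrix_inv\<close> chooses some two-sided inverse, and invertibility
    provides one.\<close>
  then show ?thesis
    using invertible_mass[OF assms] unfolding invertible_def matrix_inv_def
    by (metis (mono_tags, lifting) matrix_vector_mul_lid someI_ex)
qed

text \<open>Constant entropy variables lie in the modal span, which the projection reproduces;
  injectivity on \<open>S\<close> then recovers the state. The projected expansion is constant
  everywhere, so \<open>x\<close> may lie outside the cube.\<close>

lemma entropy_projected_const:
  assumes valid: "valid_reference_element E" and inj: "inj_on (entropy_var U) S" and "u\<^sub>0 \<in> S"
    and const: "\<And>x. x \<in> ref_cube \<Longrightarrow> eval_modal E c x = u\<^sub>0"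
  shows "entropy_projected E S U c x = u\<^sub>0"
proof -
  have "vol_node E a \<in> {x. \<forall>i. x $ i \<in> grid1d E i}" for a
    using valid by (auto simp: valid_reference_element_def tensor_product_quadrature_def
        dest: bij_betwE)
  \<comment> \<open>The solution is known to be constant only on the cube.\<close>
  then have node: "vol_node E a \<in> ref_cube" for a
    using valid by (force simp: valid_reference_element_def tensor_product_quadrature_def ref_cube_def)
  obtain w where w: "\<And>x. (\<Sum>j\<in>UNIV. basis E j x * w $ j) = 1"
    using basis_represents_one[OF valid] by blast
  have "(\<chi> a. entropy_var U (eval_modal E c (vol_node E a)) $ n)
      = vals (basis E) (vol_node E) *v (entropy_var U u\<^sub>0 $ n *\<^sub>R w)" for n
    by (simp add: const node matrix_vector_mult_scaleR)
      (simp add: vec_eq_iff matrix_vector_mult_def vals_def w)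
  then have "entropy_coeffs E U c = (\<chi> n. entropy_var U u\<^sub>0 $ n *\<^sub>R w)"
    by (simp add: entropy_coeffs_def proj_vals[OF valid])
  then have "eval_modal E (entropy_coeffs E U c) x
      = (\<chi> n. entropy_var U u\<^sub>0 $ n * (\<Sum>j\<in>UNIV. basis E j x * w $ j))"
    by (simp add: eval_modal_def sum_distrib_left mult.left_commute)
  then have "eval_modal E (entropy_coeffs E U c) x = entropy_var U u\<^sub>0"
    by (simp add: w)
  then show ?thesis
    using inj \<open>u\<^sub>0 \<in> S\<close> by (simp add: entropy_projected_def inv_into_f_f)
qed

section \<open>Free-stream preservation\<close>

theorem theorem6p1:
  fixes E :: "('v::finite, 'k::finite, 'b::finite) reference_element"
    and Q :: "3 \<Rightarrow> real^('v, 'k) node^('v, 'k) node"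
    and c\<^sub>1 :: real
    and S :: "(real^'s::finite) set"
    and f :: "real^'s \<Rightarrow> real^3^'s"
    and U :: "real^'s \<Rightarrow> real"
    and G :: "('m, 'v, 'k) mesh"
    and fs :: "real^'s \<Rightarrow> real^'s \<Rightarrow> real^3^'s"
    and fstar :: "'m \<Rightarrow> 6 \<Rightarrow> 'k \<Rightarrow> real^'s \<Rightarrow> real^'s \<Rightarrow> real^3^'s"
    and ub :: "real \<Rightarrow> 'm \<Rightarrow> 6 \<Rightarrow> 'k \<Rightarrow> real^'s"
    and T :: "real set" and t :: real
    and u :: "real \<Rightarrow> 'm \<Rightarrow> real^'b^'s"
    and u_inf :: "real^'s"
    and \<alpha> :: "real^3^'s"
  assumes "valid_reference_element E"
    and "summation_by_parts E"
    and "hybrid_operator E Q"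
    and "spd (mass E + fr_correction E c\<^sub>1)"
    and "convex_entropy S f U" and "inj_on (entropy_var U) S"
    and "\<forall>m a. 0 < jac_det G m a"
    and "discrete_gcl E G"
    and "surface_metric_consistency E G"
    and "symmetric_flux S fs" and "consistent_flux S f fs"
    and "\<forall>m l k. consistent_flux S f (fstar m l k)"
    and "nsfr_solution E Q c\<^sub>1 S U G fs fstar ub T u"
    and "t \<in> T"
    and "u_inf \<in> S" and "f u_inf = \<alpha>"
    and "free_stream E G (ub t) (u t) u_inf"
  shows "\<forall>m n.
      volume_term E Q (two_point_flux E S U G fs (u t) m n)
        + surface_term E (\<lambda>l k. \<alpha> $ n v* cofactor G m (Inr (l, k))) = 0
    \<and> nsfr_rhs E Q c\<^sub>1 S U G fs fstar (ub t) (u t) m n = 0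
    \<and> ((\<lambda>\<tau>. u \<tau> m $ n) has_vector_derivative 0) (at t within T)"
proof (intro allI)
  fix m n
  \<comment> \<open>Needed for every element \<open>m'\<close>, since the exterior state may come
    from a neighbour.\<close>
  have proj: "entropy_projected E S U (u t m') x = u_inf" for m' x
    using assms(17) by (intro entropy_projected_const assms(1,6,15)) (simp add: free_stream_def)
  have ext: "exterior_state E S U G (ub t) (u t) m l k = u_inf" for l k
    using assms(17) by (auto simp: exterior_state_def proj free_stream_def split: option.split)
  have two_point: "two_point_flux E S U G fs (u t) m n
      = (\<lambda>r r'. \<alpha> $ n v* ((1/2) *\<^sub>R (cofactor G m r + cofactor G m r')))"
    using assms(11,15,16) by (simp add: fun_eq_iff two_point_flux_def proj consistent_flux_def)
  have numerical: "numerical_flux E S U G fstar (ub t) (u t) m n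
      = (\<lambda>l k. \<alpha> $ n v* cofactor G m (Inr (l, k)))"
    using assms(12,15,16) by (simp add: fun_eq_iff numerical_flux_def proj ext consistent_flux_def)
  have residual: "volume_term E Q (two_point_flux E S U G fs (u t) m n)
      + surface_term E (\<lambda>l k. \<alpha> $ n v* cofactor G m (Inr (l, k))) = 0"
    unfolding two_point by (rule constant_flux_residual[OF assms(1,2,3,8,9)])
  \<comment> \<open>By consistency the numerical flux is the constant flux, so the weight-adjusted
    inverse acts on the residual.\<close>
  then have rhs: "nsfr_rhs E Q c\<^sub>1 S U G fs fstar (ub t) (u t) m n = 0"
    by (simp add: nsfr_rhs_def numerical)
  have "((\<lambda>\<tau>. u \<tau> m $ n) has_vector_derivative 0) (at t within T)"
    using assms(13,14) rhs unfolding nsfr_solution_def by metis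
  with residual rhs show "volume_term E Q (two_point_flux E S U G fs (u t) m n)
        + surface_term E (\<lambda>l k. \<alpha> $ n v* cofactor G m (Inr (l, k))) = 0
    \<and> nsfr_rhs E Q c\<^sub>1 S U G fs fstar (ub t) (u t) m n = 0
    \<and> ((\<lambda>\<tau>. u \<tau> m $ n) has_vector_derivative 0) (at t within T)"
    by blast
qed

end
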